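(* Let $\mathcal{H}=\mathcal{H}_1\otimes\mathcal{H}_2\otimes\mathcal{H}_3$ with $\dim\mathcal{H}_i=d_i$. For every unitary $U\in U(d_1d_2d_3)$ acting on $\mathcal{H}$ and every $ab|c\in\{12|3,13|2,23|1\}$ one has $\epsilon_{ab|c}(U)\le\tilde\epsilon_{ab|c}$, and consequently $\epsilon_1(U)\le\tilde\epsilon_1:=\frac13(\tilde\epsilon_{12|3}+\tilde\epsilon_{13|2}+\tilde\epsilon_{23|1})$, where $$\tilde\epsilon_{ab|c}:=2-2\Bigg(\prod_{i=1}^3\frac{d_i}{d_i+1}\Bigg)\left[8-\sum_{x'|y'}\frac{\min(d_{abx'},d_{cy'})-1}{\min(d_{abx'},d_{cy'})}\right],$$ the sum running over all eight ordered bipartitions $x'|y'$ of $\{1',2',3'\}$ (including $x'=\emptyset$ and $y'=\emptyset$), with $d_{abx'}=d_ad_b\prod_{i'\in x'}d_i$ and $d_{cy'}=d_c\prod_{i'\in y'}d_i$.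
   Context: For a pure state $|\psi\rangle\in\mathcal{H}$ and a bipartition $g|g'$ of $\{1,2,3\}$, $\tau_{g|g'}(|\psi\rangle)=2\big(1-\operatorname{tr}[(\operatorname{tr}_g|\psi\rangle\langle\psi|)^2]\big)$; the one-tangle is $\tau_1=\frac13(\tau_{12|3}+\tau_{13|2}+\tau_{23|1})$. For a unitary $U$ on $\mathcal{H}$, $\epsilon_{ab|c}(U)$ (resp. $\epsilon_1(U)$) is the average of $\tau_{ab|c}(U|\psi_{\rm sep}\rangle)$ (resp. $\tau_1(U|\psi_{\rm sep}\rangle)$) over $|\psi_{\rm sep}\rangle=|\psi_1\rangle\otimes|\psi_2\rangle\otimes|\psi_3\rangle$, each $|\psi_i\rangle$ drawn independently from the unitarily invariant measure on pure states of $\mathcal{H}_i$. The primed labels $1',2',3'$ refer to a copy $\mathcal{H}'=\mathcal{H}_{1'}\otimes\mathcal{H}_{2'}\otimes\mathcal{H}_{3'}$ of $\mathcal{H}$ with $\dim\mathcal{H}_{i'}=d_i$. *)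

theory Defs
  imports "HOL-Probability.Probability"
begin

definition cadjoint :: "complex^'n^'m \<Rightarrow> complex^'m^'n" where
  "cadjoint V = (\<chi> i j. cnj (V $ j $ i))"

definition unitary_cmat :: "complex^'n^'n \<Rightarrow> bool" where
  "unitary_cmat V \<longleftrightarrow> V ** cadjoint V = mat 1 \<and> cadjoint V ** V = mat 1"

definition unitarily_invariant_pure_state_measure :: "(complex^'n) measure \<Rightarrow> bool" where
  "unitarily_invariant_pure_state_measure \<mu> \<longleftrightarrow>
     prob_space \<mu> \<and> sets \<mu> = sets borel \<and> (AE \<psi> in \<mu>. norm \<psi> = 1) \<and>
     (\<forall>V. unitary_cmat V \<longrightarrow> distr \<mu> borel (\<lambda>\<psi>. V *v \<psi>) = \<mu>)"

definition tensor3 :: "complex^'a \<Rightarrow> complex^'b \<Rightarrow> complex^'c \<Rightarrow> complex^('a \<times> 'b \<times> 'c)" where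
  "tensor3 \<psi>1 \<psi>2 \<psi>3 = vec_lambda (\<lambda>(i,j,k). \<psi>1 $ i * \<psi>2 $ j * \<psi>3 $ k)"

definition rho_3 :: "complex^('a::finite \<times> 'b::finite \<times> 'c::finite) \<Rightarrow> 'c \<Rightarrow> 'c \<Rightarrow> complex" where
  "rho_3 \<psi> k k' = (\<Sum>i\<in>UNIV. \<Sum>j\<in>UNIV. \<psi> $ (i,j,k) * cnj (\<psi> $ (i,j,k')))"

definition rho_2 :: "complex^('a::finite \<times> 'b::finite \<times> 'c::finite) \<Rightarrow> 'b \<Rightarrow> 'b \<Rightarrow> complex" where
  "rho_2 \<psi> j j' = (\<Sum>i\<in>UNIV. \<Sum>k\<in>UNIV. \<psi> $ (i,j,k) * cnj (\<psi> $ (i,j',k)))"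

definition rho_1 :: "complex^('a::finite \<times> 'b::finite \<times> 'c::finite) \<Rightarrow> 'a \<Rightarrow> 'a \<Rightarrow> complex" where
  "rho_1 \<psi> i i' = (\<Sum>j\<in>UNIV. \<Sum>k\<in>UNIV. \<psi> $ (i,j,k) * cnj (\<psi> $ (i',j,k)))"

definition trace_sq :: "('i::finite \<Rightarrow> 'i \<Rightarrow> complex) \<Rightarrow> complex" where
  "trace_sq \<rho> = (\<Sum>x\<in>UNIV. \<Sum>y\<in>UNIV. \<rho> x y * \<rho> y x)"

definition tau_12_3 :: "complex^('a::finite \<times> 'b::finite \<times> 'c::finite) \<Rightarrow> real" where
  "tau_12_3 \<psi> = 2 * (1 - Re (trace_sq (rho_3 \<psi>)))"

definition tau_13_2 :: "complex^('a::finite \<times> 'b::finite \<times> 'c::finite) \<Rightarrow> real" where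
  "tau_13_2 \<psi> = 2 * (1 - Re (trace_sq (rho_2 \<psi>)))"

definition tau_23_1 :: "complex^('a::finite \<times> 'b::finite \<times> 'c::finite) \<Rightarrow> real" where
  "tau_23_1 \<psi> = 2 * (1 - Re (trace_sq (rho_1 \<psi>)))"

definition tau1 :: "complex^('a::finite \<times> 'b::finite \<times> 'c::finite) \<Rightarrow> real" where
  "tau1 \<psi> = (tau_12_3 \<psi> + tau_13_2 \<psi> + tau_23_1 \<psi>) / 3"

definition avg_prod ::
  "(complex^('a::finite \<times> 'b::finite \<times> 'c::finite) \<Rightarrow> real) \<Rightarrow> complex^('a\<times>'b\<times>'c)^('a\<times>'b\<times>'c)
   \<Rightarrow> (complex^'a) measure \<Rightarrow> (complex^'b) measure \<Rightarrow> (complex^'c) measure \<Rightarrow> real" where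
  "avg_prod f U \<mu>1 \<mu>2 \<mu>3 =
     (\<integral>p. f (U *v tensor3 (fst p) (fst (snd p)) (snd (snd p))) \<partial>(\<mu>1 \<Otimes>\<^sub>M (\<mu>2 \<Otimes>\<^sub>M \<mu>3)))"

text \<open>eps_tilde for ab|c with dab = d_a d_b, dc = d_c, and d the dimension function on {1,2,3};
  the sum runs over x' \<subseteq> {1',2',3'}, y' its complement.\<close>
definition eps_tilde :: "nat \<Rightarrow> nat \<Rightarrow> (nat \<Rightarrow> nat) \<Rightarrow> real" where
  "eps_tilde dab dc d =
     2 - 2 * (\<Prod>i\<in>{1,2,3}. real (d i) / (real (d i) + 1)) *
       (8 - (\<Sum>x\<in>Pow {1,2,3::nat}.
               (let m = min (dab * (\<Prod>i\<in>x. d i)) (dc * (\<Prod>i\<in>{1,2,3} - x. d i))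
                in (real m - 1) / real m)))"

end

theory Submission
  imports Defs
begin

text \<open>
  Invariance under diagonal phases and two-coordinate Hadamard rotations determines the fourth
  moments of a random pure state:
  \<open>E[\<psi> i * \<psi> j * cnj (\<psi> k) * cnj (\<psi> l)]\<close> is \<open>1 / (n * (n + 1))\<close> times
  \<open>[k = i, l = j] + [k = j, l = i]\<close>. For a product state the three binomials multiply out to a
  sum over the eight subsets \<open>x'\<close> of the tensor factors, and the mean purity becomes a sum of the
  purities of \<open>U\<close>, read as a state on two copies of the space, across the cuts \<open>ab x' | c y'\<close>.
  By the Cauchy-Schwarz inequality a purity is at least the reciprocal of the smaller dimension.
\<close>

subsection \<open>Fourth moments of an invariant measure\<close>

text \<open>The purities below are linear combinations of these monomials, so their means are all
  that is needed from the measures.\<close>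

definition moment :: "'n \<Rightarrow> 'n \<Rightarrow> 'n \<Rightarrow> 'n \<Rightarrow> complex^'n \<Rightarrow> complex" where
  "moment i j k l \<psi> = \<psi> $ i * \<psi> $ j * cnj (\<psi> $ k) * cnj (\<psi> $ l)"

lemma borel_measurable_moment [measurable]: "moment i j k l \<in> borel_measurable borel"
  unfolding moment_def
  by (intro borel_measurable_continuous_onI continuous_intros)

context
  fixes \<mu> :: "(complex^'n) measure"
  assumes \<mu>: "unitarily_invariant_pure_state_measure \<mu>"
begin

lemma prob_space_invariant: "prob_space \<mu>"
  and sets_invariant [measurable_cong]: "sets \<mu> = sets borel"
  and AE_norm_invariant: "AE \<psi> in \<mu>. norm \<psi> = 1"
  and distr_invariant: "unitary_cmat V \<Longrightarrow> distr \<mu> borel (\<lambda>\<psi>. V *v \<psi>) = \<mu>"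
  using \<mu> by (auto simp: unitarily_invariant_pure_state_measure_def)

lemma integrable_moment: "integrable \<mu> (moment i j k l)"
proof -
  interpret prob_space \<mu> by (rule prob_space_invariant)
  show ?thesis
  proof (rule integrable_const_bound[where B = 1])
    show "AE \<psi> in \<mu>. norm (moment i j k l \<psi>) \<le> 1"
      using AE_norm_invariant
    proof eventually_elim
      case (elim \<psi>)
      have le: "norm (\<psi> $ r) \<le> 1" for r
        using Finite_Cartesian_Product.norm_nth_le[of \<psi> r] elim by simp
      have "norm (\<psi> $ i) * norm (\<psi> $ j) * norm (\<psi> $ k) * norm (\<psi> $ l) \<le> 1 * 1 * 1 * 1"
        by (intro mult_mono le) auto
      then show ?case
        by (simp add: moment_def norm_mult)
    qed
  qed measurable
qed

text \<open>Invariance enters only in this form, with a diagonal phase matrix and with a Hadamard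
  rotation for \<open>V\<close>.\<close>

lemma integral_moment_unitary:
  assumes "unitary_cmat V"
  shows "(\<integral>\<psi>. moment i j k l (V *v \<psi>) \<partial>\<mu>) = (\<integral>\<psi>. moment i j k l \<psi> \<partial>\<mu>)"
proof -
  have "(\<lambda>\<psi>. V *v \<psi>) \<in> borel_measurable borel"
    by (intro borel_measurable_continuous_onI linear_continuous_on)
       (simp add: matrix_vector_mul_bounded_linear)
  then have [measurable]: "(\<lambda>\<psi>. V *v \<psi>) \<in> measurable \<mu> borel"
    by measurable
  have "(\<integral>\<psi>. moment i j k l \<psi> \<partial>distr \<mu> borel (\<lambda>\<psi>. V *v \<psi>))
      = (\<integral>\<psi>. moment i j k l (V *v \<psi>) \<partial>\<mu>)"
    by (rule integral_distr) measurable
  then show ?thesis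
    by (simp add: distr_invariant[OF assms])
qed

text \<open>Multiplying the single coordinate \<open>p\<close> by \<open>\<i>\<close> multiplies the moment by a power of
  \<open>\<i>\<close> which is different from 1 for a suitable \<open>p\<close>, unless \<open>{i, j} = {k, l}\<close> as multisets.\<close>

lemma integral_moment_eq_0:
  assumes "\<not> (k = i \<and> l = j)" "\<not> (k = j \<and> l = i)"
  shows "(\<integral>\<psi>. moment i j k l \<psi> \<partial>\<mu>) = 0"
proof -
  define c :: "'n \<Rightarrow> 'n \<Rightarrow> complex" where "c p r = (if r = p then \<i> else 1)" for p r
  define V :: "'n \<Rightarrow> complex^'n^'n" where "V p = (\<chi> r s. if r = s then c p r else 0)" for p
  have V: "V p *v \<psi> = (\<chi> r. c p r * \<psi> $ r)" for p \<psi>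
    by (simp add: V_def matrix_vector_mult_def vec_eq_iff if_distrib[of "\<lambda>x. x * _"] cong: if_cong)
  have "unitary_cmat (V p)" for p
    by (auto simp: V_def c_def unitary_cmat_def cadjoint_def matrix_matrix_mult_def mat_def vec_eq_iff
          if_distrib[of "\<lambda>x. x * _"] if_distrib[of "\<lambda>x. _ * x"] if_distrib[of cnj] cong: if_cong)
  from integral_moment_unitary[OF this]
  have "(c p i * c p j * cnj (c p k) * cnj (c p l)) * (\<integral>\<psi>. moment i j k l \<psi> \<partial>\<mu>)
      = (\<integral>\<psi>. moment i j k l \<psi> \<partial>\<mu>)" for p
    by (simp add: V moment_def mult_ac flip: integral_mult_right_zero)
  moreover have "\<exists>p. c p i * c p j * cnj (c p k) * cnj (c p l) \<noteq> 1"
  proof (rule ccontr)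
    assume "\<not> ?thesis"
    then have "c p i * c p j * cnj (c p k) * cnj (c p l) = 1" for p by blast
    \<comment> \<open>The factor is \<open>\<i>\<close> to the number of occurrences of
      \<open>p\<close> among \<open>i\<close>, \<open>j\<close> minus that among \<open>k\<close>,
      \<open>l\<close>. This exponent lies between -2 and 2, so the factor is 1 only if the counts
      agree; testing \<open>p\<close> at the four indices compares the multisets.\<close>
    from this[of i] this[of j] this[of l] this[of k] show False
      using assms by (auto simp: c_def complex_eq_iff split: if_splits)
  qed
  ultimately show ?thesis
    by (metis mult_cancel_right1)
qed

text \<open>Obtained from invariance under a Hadamard rotation in the coordinates \<open>i\<close> and \<open>j\<close>.\<close>

lemma integral_moment_diag:
  assumes "i \<noteq> j"
  shows "(\<integral>\<psi>. moment i i i i \<psi> \<partial>\<mu>) = 2 * (\<integral>\<psi>. moment i j i j \<psi> \<partial>\<mu>)"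
    and "(\<integral>\<psi>. moment j j j j \<psi> \<partial>\<mu>) = 2 * (\<integral>\<psi>. moment i j i j \<psi> \<partial>\<mu>)"
proof -
  define h :: complex where "h = of_real (1 / sqrt 2)"
  have hh: "h * h = 1 / 2" "h * (h * x) = x / 2" "cnj h = h" for x
    by (simp_all add: h_def flip: of_real_mult mult.assoc)
  have h4: "h * x * (h * y) * (h * z) * (h * w) = x * y * z * w / 4" for x y z w
  proof -
    have "h * x * (h * y) * (h * z) * (h * w) = (h * h) * (h * h) * (x * y * z * w)"
      by (simp only: mult_ac)
    then show ?thesis by (simp add: hh(1))
  qed
  define V :: "complex^'n^'n" where "V = (\<chi> r s.
     if r = i then (if s = i then h else if s = j then h else 0)
     else if r = j then (if s = i then h else if s = j then - h else 0)
     else if s = r then 1 else 0)"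
  have two: "(\<Sum>s\<in>UNIV. (if s = i then x else if s = j then y else 0) * f s) = x * f i + y * f j"
    for x y :: complex and f :: "'n \<Rightarrow> complex"
  proof -
    have "(\<Sum>s\<in>UNIV. (if s = i then x else if s = j then y else 0) * f s)
        = (\<Sum>s\<in>UNIV. (if s = i then x * f s else 0) + (if s = j then y * f s else 0))"
      using assms by (intro sum.cong) auto
    then show ?thesis
      by (simp add: sum.distrib)
  qed
  have V: "V *v \<psi> = (\<chi> r. if r = i then h * (\<psi> $ i + \<psi> $ j)
                       else if r = j then h * (\<psi> $ i - \<psi> $ j) else \<psi> $ r)" for \<psi>
  proof -
    have "(V *v \<psi>) $ r = (if r = i then h * \<psi> $ i + h * \<psi> $ j
            else if r = j then h * \<psi> $ i + (- h) * \<psi> $ j else \<psi> $ r)" for r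
    proof (cases "r = i \<or> r = j")
      case True
      then show ?thesis using two[of h h] two[of h "- h"] assms
        by (auto simp: V_def matrix_vector_mult_def)
    next
      case False
      then show ?thesis
        by (simp add: V_def matrix_vector_mult_def if_distrib[of "\<lambda>x. x * _"] cong: if_cong)
    qed
    then show ?thesis
      by (simp add: vec_eq_iff algebra_simps)
  qed
  have "V ** V = mat 1"
    unfolding matrix_eq matrix_vector_mul_assoc[symmetric]
    using assms by (auto simp: V vec_eq_iff algebra_simps hh)
  moreover have "cadjoint V = V"
    using assms by (auto simp: cadjoint_def V_def vec_eq_iff hh)
  ultimately have "unitary_cmat V"
    by (simp add: unitary_cmat_def)
  note inv = integral_moment_unitary[OF this]
  define M where "M p q r s = (\<integral>\<psi>. moment p q r s \<psi> \<partial>\<mu>)" for p q r s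
  \<comment> \<open>The signs in row \<open>j\<close> of \<open>V\<close>: the difference of the
    coordinates \<open>i\<close> and \<open>j\<close> is their sum weighted by
    \<open>e\<close>.\<close>
  define e where "e p = (if p = j then -1 else 1 :: complex)" for p
  have M0: "M p q r s = 0" if "\<not> (r = p \<and> s = q)" "\<not> (r = q \<and> s = p)" for p q r s
    unfolding M_def using that by (rule integral_moment_eq_0)
  \<comment> \<open>Coordinate \<open>i\<close> of \<open>V *v \<psi>\<close> is \<open>h\<close>
    times a sum of two coordinates; the fourth power of its modulus expands into sixteen moments
    with weight \<open>1 / 4\<close>.\<close>
  have "(\<Sum>p\<in>{i,j}. \<Sum>q\<in>{i,j}. \<Sum>r\<in>{i,j}. \<Sum>s\<in>{i,j}. M p q r s) / 4
     = (\<integral>\<psi>. (\<Sum>p\<in>{i,j}. \<Sum>q\<in>{i,j}. \<Sum>r\<in>{i,j}. \<Sum>s\<in>{i,j}. moment p q r s \<psi>) / 4 \<partial>\<mu>)"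
    by (simp add: M_def integrable_moment del: sum.insert)
  also have "\<dots> = (\<integral>\<psi>. moment i i i i (V *v \<psi>) \<partial>\<mu>)"
    using assms by (intro Bochner_Integration.integral_cong)
      (simp_all add: moment_def V hh(3) h4, simp add: algebra_simps)
  finally have 1: "(\<Sum>p\<in>{i,j}. \<Sum>q\<in>{i,j}. \<Sum>r\<in>{i,j}. \<Sum>s\<in>{i,j}. M p q r s) / 4 = M i i i i"
    by (simp add: inv M_def)
  have "(\<Sum>p\<in>{i,j}. \<Sum>q\<in>{i,j}. \<Sum>r\<in>{i,j}. \<Sum>s\<in>{i,j}. e p * e q * e r * e s * M p q r s) / 4
     = (\<integral>\<psi>. (\<Sum>p\<in>{i,j}. \<Sum>q\<in>{i,j}. \<Sum>r\<in>{i,j}. \<Sum>s\<in>{i,j}.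
                e p * e q * e r * e s * moment p q r s \<psi>) / 4 \<partial>\<mu>)"
    by (simp add: M_def integrable_moment del: sum.insert)
  also have "\<dots> = (\<integral>\<psi>. moment j j j j (V *v \<psi>) \<partial>\<mu>)"
    using assms by (intro Bochner_Integration.integral_cong)
      (simp_all add: moment_def V hh(3) h4 e_def, simp add: algebra_simps)
  finally have 2: "(\<Sum>p\<in>{i,j}. \<Sum>q\<in>{i,j}. \<Sum>r\<in>{i,j}. \<Sum>s\<in>{i,j}. e p * e q * e r * e s * M p q r s) / 4
     = M j j j j"
    by (simp add: inv M_def)
  have "moment i j j i = moment i j i j" "moment j i i j = moment i j i j" "moment j i j i = moment i j i j"
    by (auto simp: moment_def fun_eq_iff mult_ac)
  then have sym: "M i j j i = M i j i j" "M j i i j = M i j i j" "M j i j i = M i j i j"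
    by (simp_all add: M_def)
  \<comment> \<open>Six of the sixteen terms survive \<open>M0\<close>: two diagonal ones and four
    equal to \<open>M i j i j\<close>. The signs \<open>e\<close> cancel in each of them, so both
    diagonal moments equal the same expression, and solving for it gives the factor 2.\<close>
  have 1: "(M i i i i + M j j j j + 4 * M i j i j) / 4 = M i i i i"
    using 1 assms by (simp add: M0 sym ac_simps)
  moreover have 2: "(M i i i i + M j j j j + 4 * M i j i j) / 4 = M j j j j"
    using 2 assms by (simp add: M0 sym e_def ac_simps)
  ultimately have "M i i i i = M j j j j" by simp
  with 1 show "(\<integral>\<psi>. moment i i i i \<psi> \<partial>\<mu>) = 2 * (\<integral>\<psi>. moment i j i j \<psi> \<partial>\<mu>)"
    and "(\<integral>\<psi>. moment j j j j \<psi> \<partial>\<mu>) = 2 * (\<integral>\<psi>. moment i j i j \<psi> \<partial>\<mu>)"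
    by (auto simp: field_simps M_def)
qed

text \<open>The integrands add up to the fourth power of the norm, which is 1 almost everywhere.
  This normalisation fixes the one constant that the symmetries leave free.\<close>

lemma sum_integral_moment: "(\<Sum>i\<in>UNIV. \<Sum>j\<in>UNIV. \<integral>\<psi>. moment i j i j \<psi> \<partial>\<mu>) = 1"
proof -
  interpret prob_space \<mu> by (rule prob_space_invariant)
  have "(\<Sum>i\<in>UNIV. \<Sum>j\<in>UNIV. \<integral>\<psi>. moment i j i j \<psi> \<partial>\<mu>)
      = (\<integral>\<psi>. (\<Sum>i\<in>UNIV. \<Sum>j\<in>UNIV. moment i j i j \<psi>) \<partial>\<mu>)"
    by (simp add: integrable_moment)
  also have "\<dots> = (\<integral>\<psi>. 1 \<partial>\<mu>)"
  proof (rule integral_cong_AE)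
    show "AE \<psi> in \<mu>. (\<Sum>i\<in>UNIV. \<Sum>j\<in>UNIV. moment i j i j \<psi>) = 1"
      using AE_norm_invariant
    proof eventually_elim
      case (elim \<psi>)
      have "(\<Sum>i\<in>UNIV. \<psi> $ i * cnj (\<psi> $ i)) = of_real (\<Sum>i\<in>UNIV. (norm (\<psi> $ i))\<^sup>2)"
        by (simp only: of_real_sum complex_norm_square)
      also have "(\<Sum>i\<in>UNIV. (norm (\<psi> $ i))\<^sup>2) = (norm \<psi>)\<^sup>2"
        by (simp add: norm_vec_def L2_set_def sum_nonneg)
      finally have "(\<Sum>i\<in>UNIV. \<psi> $ i * cnj (\<psi> $ i)) = 1"
        using elim by simp
      moreover have "(\<Sum>i\<in>UNIV. \<Sum>j\<in>UNIV. moment i j i j \<psi>)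
          = (\<Sum>i\<in>UNIV. \<psi> $ i * cnj (\<psi> $ i)) * (\<Sum>i\<in>UNIV. \<psi> $ i * cnj (\<psi> $ i))"
        by (simp add: sum_product moment_def mult_ac)
      ultimately show ?case by simp
    qed
  qed measurable
  finally show ?thesis by (simp add: prob_space)
qed

text \<open>With \<open>B\<close> for a mixed moment, the \<open>n\<close> diagonal moments are
  \<open>2 * B\<close> and the other \<open>n * (n - 1)\<close> are \<open>B\<close>, so
  normalisation gives \<open>B * n * (n + 1) = 1\<close>. For \<open>i = j\<close> both indicators
  can hold at once, which accounts for the doubled diagonal value.\<close>

lemma integral_moment:
  "(\<integral>\<psi>. moment i j k l \<psi> \<partial>\<mu>)
     = (of_bool (k = i \<and> l = j) + of_bool (k = j \<and> l = i)) / of_nat (CARD('n) * (CARD('n) + 1))"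
proof -
  define M where "M p q r s = (\<integral>\<psi>. moment p q r s \<psi> \<partial>\<mu>)" for p q r s
  define i0 :: 'n where "i0 = undefined"
  \<comment> \<open>Half a diagonal moment at an arbitrary reference index: this also makes sense in
    dimension one, where there are no mixed moments.\<close>
  define B where "B = M i0 i0 i0 i0 / 2"
  have swap: "M p q r s = M p q s r" for p q r s
    unfolding M_def moment_def by (simp add: mult_ac)
  have A: "M p p p p = 2 * B" for p
  proof (cases "p = i0")
    case False
    then have "M p p p p = 2 * M p i0 p i0" "M i0 i0 i0 i0 = 2 * M p i0 p i0"
      unfolding M_def by (simp_all only: integral_moment_diag)
    then show ?thesis by (simp add: B_def)
  qed (simp add: B_def)
  have B: "M p q p q = (if p = q then 2 * B else B)" for p q
  proof (cases "p = q")
    case False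
    then have "M p p p p = 2 * M p q p q"
      unfolding M_def by (rule integral_moment_diag)
    then show ?thesis using False by (simp add: A)
  qed (simp add: A)
  have "(\<Sum>q\<in>UNIV. if p = q then 2 * B else B) = B * (of_nat (CARD('n)) + 1)" for p :: 'n
  proof -
    have "(\<Sum>q\<in>UNIV. if p = q then 2 * B else B) = (\<Sum>q\<in>UNIV. (if p = q then B else 0) + B)"
      by (intro sum.cong) auto
    then show ?thesis by (simp add: sum.distrib algebra_simps)
  qed
  then have "B * of_nat (CARD('n) * (CARD('n) + 1)) = 1"
    using sum_integral_moment by (simp add: B algebra_simps flip: M_def)
  then have B': "B = 1 / of_nat (CARD('n) * (CARD('n) + 1))"
    by (metis mult_zero_right nonzero_eq_divide_eq zero_neq_one)
  consider "k = i" "l = j" | "k = j" "l = i" | "\<not> (k = i \<and> l = j)" "\<not> (k = j \<and> l = i)"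
    by blast
  then show ?thesis
  proof cases
    case 1
    then show ?thesis using B[of i j] by (auto simp: M_def B')
  next
    case 2
    then show ?thesis using B[of i j] unfolding swap[of i j i j] by (auto simp: M_def B')
  next
    case 3
    show ?thesis by (simp only: integral_moment_eq_0[OF 3] 3 of_bool_eq) simp
  qed
qed

end

subsection \<open>Purity across a cut\<close>

text \<open>An identification of the index type with \<open>A \<times> B\<close> under which \<open>f\<close> takes the \<open>A\<close>-part of
  its first and the \<open>B\<close>-part of its second argument. The sum \<open>swap_sum f w\<close> is then the trace of
  the square of the \<open>B\<close>-marginal (equivalently, of the \<open>A\<close>-marginal) of \<open>w\<close>.\<close>

definition splitting :: "('p \<Rightarrow> 'p \<Rightarrow> 'p) \<Rightarrow> 'p set \<Rightarrow> 'p set \<Rightarrow> bool" where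
  "splitting f A B \<longleftrightarrow> bij_betw (\<lambda>(a, b). f a b) (A \<times> B) UNIV \<and>
     (\<forall>a\<in>A. \<forall>b\<in>B. \<forall>a'\<in>A. \<forall>b'\<in>B. f (f a b) (f a' b') = f a b')"

definition swap_sum :: "('p::finite \<Rightarrow> 'p \<Rightarrow> 'p) \<Rightarrow> ('p \<Rightarrow> complex) \<Rightarrow> complex" where
  "swap_sum f w = (\<Sum>p\<in>UNIV. \<Sum>q\<in>UNIV. w p * w q * cnj (w (f p q)) * cnj (w (f q p)))"

text \<open>The array \<open>v\<close> has the reduced density matrix \<open>r\<close> on
  \<open>B\<close>, and the right-hand side is the sum of the squared moduli of its entries.
  Discarding the off-diagonal entries and applying Cauchy-Schwarz to the diagonal leaves the squared
  trace over \<open>card B\<close>.\<close>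

lemma sum_rect_ge:
  fixes v :: "'a \<Rightarrow> 'b \<Rightarrow> complex"
  assumes "finite A" "finite B" "B \<noteq> {}"
  shows "(\<Sum>a\<in>A. \<Sum>b\<in>B. (norm (v a b))\<^sup>2)\<^sup>2 / card B
       \<le> Re (\<Sum>a\<in>A. \<Sum>b\<in>B. \<Sum>a'\<in>A. \<Sum>b'\<in>B. v a b * v a' b' * cnj (v a b') * cnj (v a' b))"
proof -
  define r where "r b b' = (\<Sum>a\<in>A. v a b * cnj (v a b'))" for b b'
  define s where "s b = (\<Sum>a\<in>A. (norm (v a b))\<^sup>2)" for b
  have r_diag: "r b b = of_real (s b)" for b
    unfolding r_def s_def by (simp only: of_real_sum complex_norm_square)
  have "(\<Sum>a\<in>A. \<Sum>b\<in>B. (norm (v a b))\<^sup>2)\<^sup>2 / card B = (\<Sum>b\<in>B. s b)\<^sup>2 / card B"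
    unfolding s_def by (subst sum.swap) simp
  also have "(\<Sum>b\<in>B. s b)\<^sup>2 \<le> card B * (\<Sum>b\<in>B. (s b)\<^sup>2)"
    by (rule sum_squared_le_sum_of_squares[of s B, simplified mult.commute])
  then have "(\<Sum>b\<in>B. s b)\<^sup>2 / card B \<le> (\<Sum>b\<in>B. (s b)\<^sup>2)"
    using assms by (simp add: divide_le_eq card_gt_0_iff mult.commute)
  also have "\<dots> = (\<Sum>b\<in>B. (norm (r b b))\<^sup>2)"
    by (simp add: r_diag)
  also have "\<dots> \<le> (\<Sum>b\<in>B. \<Sum>b'\<in>B. (norm (r b b'))\<^sup>2)"
    using assms by (intro sum_mono member_le_sum) auto
  also have "\<dots> = Re (\<Sum>b\<in>B. \<Sum>b'\<in>B. r b b' * cnj (r b b'))"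
    by (simp add: complex_norm_square[symmetric] del: of_real_power)
  also have "(\<Sum>b\<in>B. \<Sum>b'\<in>B. r b b' * cnj (r b b')) =
     (\<Sum>b\<in>B. \<Sum>b'\<in>B. \<Sum>a\<in>A. \<Sum>a'\<in>A. v a b * v a' b' * cnj (v a b') * cnj (v a' b))"
    by (simp add: r_def sum_product mult_ac)
  also have "\<dots> = (\<Sum>b\<in>B. \<Sum>a\<in>A. \<Sum>b'\<in>B. \<Sum>a'\<in>A. v a b * v a' b' * cnj (v a b') * cnj (v a' b))"
    by (intro sum.cong refl sum.swap)
  also have "\<dots> = (\<Sum>a\<in>A. \<Sum>b\<in>B. \<Sum>b'\<in>B. \<Sum>a'\<in>A. v a b * v a' b' * cnj (v a b') * cnj (v a' b))"
    by (rule sum.swap)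
  also have "\<dots> = (\<Sum>a\<in>A. \<Sum>b\<in>B. \<Sum>a'\<in>A. \<Sum>b'\<in>B. v a b * v a' b' * cnj (v a b') * cnj (v a' b))"
    by (intro sum.cong refl sum.swap)
  finally show ?thesis .
qed

text \<open>Both marginals of a pure state have the same purity, so \<open>sum_rect_ge\<close>
  applies to either side of the cut; the smaller side gives the stronger bound.\<close>

lemma swap_sum_ge:
  fixes w :: "'p::finite \<Rightarrow> complex"
  assumes "splitting f A B"
  shows "(\<Sum>p\<in>UNIV. (norm (w p))\<^sup>2)\<^sup>2 / min (card A) (card B) \<le> Re (swap_sum f w)"
proof -
  define v where "v a b = w (f a b)" for a b
  have bij: "bij_betw (\<lambda>(a, b). f a b) (A \<times> B) UNIV"
    using assms by (simp add: splitting_def)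
  have ne: "A \<noteq> {}" "B \<noteq> {}"
    using bij by (auto simp: bij_betw_def)
  have reindex: "(\<Sum>p\<in>UNIV. g p) = (\<Sum>a\<in>A. \<Sum>b\<in>B. g (f a b))" for g :: "'p \<Rightarrow> 'z::comm_monoid_add"
    by (simp add: sum.reindex_bij_betw[OF bij, symmetric] sum.cartesian_product case_prod_unfold)
  have N: "(\<Sum>p\<in>UNIV. (norm (w p))\<^sup>2) = (\<Sum>a\<in>A. \<Sum>b\<in>B. (norm (v a b))\<^sup>2)"
    by (simp add: reindex v_def)
  have T: "swap_sum f w =
     (\<Sum>a\<in>A. \<Sum>b\<in>B. \<Sum>a'\<in>A. \<Sum>b'\<in>B. v a b * v a' b' * cnj (v a b') * cnj (v a' b))"
    unfolding swap_sum_def reindex v_def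
    using assms by (intro sum.cong refl) (simp add: splitting_def)
  \<comment> \<open>The same number in the form belonging to the transposed array.\<close>
  have T': "swap_sum f w =
     (\<Sum>b\<in>B. \<Sum>a\<in>A. \<Sum>b'\<in>B. \<Sum>a'\<in>A. v a b * v a' b' * cnj (v a' b) * cnj (v a b'))"
    unfolding T 
    by (rule trans[OF sum.swap], rule sum.cong[OF refl], rule sum.cong[OF refl],
        rule trans[OF sum.swap], simp add: mult_ac)
  have "(\<Sum>p\<in>UNIV. (norm (w p))\<^sup>2)\<^sup>2 / card B \<le> Re (swap_sum f w)"
    unfolding N T by (rule sum_rect_ge) (use ne in auto)
  moreover have "(\<Sum>p\<in>UNIV. (norm (w p))\<^sup>2)\<^sup>2 / card A \<le> Re (swap_sum f w)"
    unfolding N T' by (subst sum.swap, rule sum_rect_ge[where v = "\<lambda>b a. v a b"]) (use ne in auto)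
  ultimately show ?thesis
    by (simp add: min_def)
qed

section \<open>Cuts of tensor products, assembled factor by factor\<close>

definition pick :: "bool \<Rightarrow> 'x \<Rightarrow> 'x \<Rightarrow> 'x" where
  "pick c x y = (if c then x else y)"

definition pair_op :: "('x \<Rightarrow> 'x \<Rightarrow> 'x) \<Rightarrow> ('y \<Rightarrow> 'y \<Rightarrow> 'y) \<Rightarrow> 'x \<times> 'y \<Rightarrow> 'x \<times> 'y \<Rightarrow> 'x \<times> 'y" where
  "pair_op f g p q = (f (fst p) (fst q), g (snd p) (snd q))"

lemma pair_op_simp [simp]: "pair_op f g (a, b) (a', b') = (f a a', g b b')"
  by (simp add: pair_op_def)

text \<open>A single factor lies wholly on one side of the cut; the other side is the trivial space,
  represented by a one-point index set.\<close>

lemma splitting_pick: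
  "\<exists>A B. splitting (pick c :: 'x::finite \<Rightarrow> _) A B \<and>
     card A = CARD('x) ^ of_bool c \<and> card B = CARD('x) ^ of_bool (\<not> c)"
proof (cases c)
  case True
  have "splitting (pick c) UNIV {undefined :: 'x}"
    using True by (auto simp: splitting_def pick_def bij_betw_def inj_on_def image_iff)
  then show ?thesis using True by (intro exI[of _ UNIV] exI[of _ "{undefined}"]) auto
next
  case False
  have "splitting (pick c) {undefined :: 'x} UNIV"
    using False by (auto simp: splitting_def pick_def bij_betw_def inj_on_def image_iff)
  then show ?thesis using False by (intro exI[of _ UNIV] exI[of _ "{undefined}"]) auto
qed

text \<open>Cuts of two factors combine coordinatewise. This serves twice: to assemble
  \<open>mix\<close> from three single factors, and to join a cut of the row indices of
  \<open>U\<close> with a cut of its column indices.\<close>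

lemma splitting_pair_op:
  assumes "splitting f A B" "splitting g C D"
  shows "splitting (pair_op f g) (A \<times> C) (B \<times> D)"
proof -
  have f: "inj_on (\<lambda>(a, b). f a b) (A \<times> B)" "(\<lambda>(a, b). f a b) ` (A \<times> B) = UNIV"
   and g: "inj_on (\<lambda>(a, b). g a b) (C \<times> D)" "(\<lambda>(a, b). g a b) ` (C \<times> D) = UNIV"
    using assms by (auto simp: splitting_def bij_betw_def)
  have "inj_on (\<lambda>(p, q). pair_op f g p q) ((A \<times> C) \<times> (B \<times> D))"
    using f(1) g(1) by (auto simp: inj_on_def)
  moreover have "(x, y) \<in> (\<lambda>(p, q). pair_op f g p q) ` ((A \<times> C) \<times> (B \<times> D))" for x y
  proof -
    have "x \<in> (\<lambda>(a, b). f a b) ` (A \<times> B)" "y \<in> (\<lambda>(a, b). g a b) ` (C \<times> D)"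
      unfolding f g by auto
    then obtain a b c d where "a \<in> A" "b \<in> B" "x = f a b" "c \<in> C" "d \<in> D" "y = g c d"
      by auto
    then show ?thesis
      by (intro image_eqI[of _ _ "((a, c), (b, d))"]) auto
  qed
  then have "(\<lambda>(p, q). pair_op f g p q) ` ((A \<times> C) \<times> (B \<times> D)) = UNIV"
    by auto
  ultimately show ?thesis
    using assms unfolding splitting_def bij_betw_def by simp
qed

text \<open>A subset of the three tensor factors is encoded by its characteristic triple of Booleans.\<close>

definition mix :: "bool \<times> bool \<times> bool \<Rightarrow> 'a \<times> 'b \<times> 'c \<Rightarrow> 'a \<times> 'b \<times> 'c \<Rightarrow> 'a \<times> 'b \<times> 'c" where
  "mix X = pair_op (pick (fst X)) (pair_op (pick (fst (snd X))) (pick (snd (snd X))))"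

definition dim_of :: "('a::finite \<times> 'b::finite \<times> 'c::finite) itself \<Rightarrow> bool \<times> bool \<times> bool \<Rightarrow> nat" where
  "dim_of _ X = CARD('a) ^ of_bool (fst X) * CARD('b) ^ of_bool (fst (snd X)) * CARD('c) ^ of_bool (snd (snd X))"

definition neg :: "bool \<times> bool \<times> bool \<Rightarrow> bool \<times> bool \<times> bool" where
  "neg X = (\<not> fst X, \<not> fst (snd X), \<not> snd (snd X))"

lemma splitting_mix:
  "\<exists>A B. splitting (mix X :: 'a::finite \<times> 'b::finite \<times> 'c::finite \<Rightarrow> _) A B \<and>
     card A = dim_of TYPE('a \<times> 'b \<times> 'c) X \<and> card B = dim_of TYPE('a \<times> 'b \<times> 'c) (neg X)"
proof -
  obtain X1 X2 X3 where X: "X = (X1, X2, X3)" by (cases X)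
  obtain A1 B1 where 1: "splitting (pick X1 :: 'a \<Rightarrow> _) A1 B1"
     "card A1 = CARD('a) ^ of_bool X1" "card B1 = CARD('a) ^ of_bool (\<not> X1)"
    using splitting_pick by blast
  obtain A2 B2 where 2: "splitting (pick X2 :: 'b \<Rightarrow> _) A2 B2"
     "card A2 = CARD('b) ^ of_bool X2" "card B2 = CARD('b) ^ of_bool (\<not> X2)"
    using splitting_pick by blast
  obtain A3 B3 where 3: "splitting (pick X3 :: 'c \<Rightarrow> _) A3 B3"
     "card A3 = CARD('c) ^ of_bool X3" "card B3 = CARD('c) ^ of_bool (\<not> X3)"
    using splitting_pick by blast
  have "splitting (mix X) (A1 \<times> A2 \<times> A3) (B1 \<times> B2 \<times> B3)"
    unfolding mix_def X fst_conv snd_conv by (intro splitting_pair_op 1 2 3)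
  moreover have "card (A1 \<times> A2 \<times> A3) = dim_of TYPE('a \<times> 'b \<times> 'c) X"
      "card (B1 \<times> B2 \<times> B3) = dim_of TYPE('a \<times> 'b \<times> 'c) (neg X)"
    by (simp_all add: card_cartesian_product dim_of_def X neg_def 1 2 3)
  ultimately show ?thesis by blast
qed

text \<open>Every row has norm 1, so \<open>U\<close> read as a vector on two copies of the space
  has the dimension as its squared norm. Hence the squared dimension in the later
  numerators.\<close>

lemma unitary_norm_sum:
  fixes U :: "complex^'n^'n"
  assumes "unitary_cmat U"
  shows "(\<Sum>p\<in>UNIV. (norm (U $ fst p $ snd p))\<^sup>2) = CARD('n)"
proof -
  have "(\<Sum>j\<in>UNIV. U $ i $ j * cnj (U $ i $ j)) = 1" for i
  proof -
    have "(U ** cadjoint U) $ i $ i = mat 1 $ i $ i"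
      using assms by (simp add: unitary_cmat_def)
    then show ?thesis by (simp add: matrix_matrix_mult_def cadjoint_def mat_def)
  qed
  then have "complex_of_real (\<Sum>j\<in>UNIV. (norm (U $ i $ j))\<^sup>2) = 1" for i
    by (simp only: of_real_sum complex_norm_square)
  then have "(\<Sum>j\<in>UNIV. (norm (U $ i $ j))\<^sup>2) = 1" for i
    using of_real_eq_1_iff by blast
  then show ?thesis
    by (simp add: sum.cartesian_product' flip: UNIV_Times_UNIV)
qed

text \<open>\<open>True\<close> marks the factors that are traced out. Writing out the square joins
  each index of the reduced state with the traced indices into a full triple, and the conjugated
  entries then carry the last, middle or first index exchanged.\<close>

lemma trace_sq_rho:
  fixes \<psi> :: "complex^('a::finite \<times> 'b::finite \<times> 'c::finite)"
  shows "trace_sq (rho_3 \<psi>) = swap_sum (mix (True, True, False)) (($) \<psi>)"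
    and "trace_sq (rho_2 \<psi>) = swap_sum (mix (True, False, True)) (($) \<psi>)"
    and "trace_sq (rho_1 \<psi>) = swap_sum (mix (False, True, True)) (($) \<psi>)"
proof -
  show "trace_sq (rho_3 \<psi>) = swap_sum (mix (True, True, False)) (($) \<psi>)"
    unfolding trace_sq_def rho_3_def swap_sum_def sum_product sum.cartesian_product UNIV_Times_UNIV
    by (rule sum.reindex_bij_witness[of _
          "\<lambda>((i, j, k), (i', j', k')). (k, k', (i, j), (i', j'))"
          "\<lambda>(k, k', (i, j), (i', j')). ((i, j, k), (i', j', k'))"])
       (auto simp: mix_def pick_def)
  show "trace_sq (rho_2 \<psi>) = swap_sum (mix (True, False, True)) (($) \<psi>)"
    unfolding trace_sq_def rho_2_def swap_sum_def sum_product sum.cartesian_product UNIV_Times_UNIV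
    by (rule sum.reindex_bij_witness[of _
          "\<lambda>((i, j, k), (i', j', k')). (j, j', (i, k), (i', k'))"
          "\<lambda>(j, j', (i, k), (i', k')). ((i, j, k), (i', j', k'))"])
       (auto simp: mix_def pick_def)
  show "trace_sq (rho_1 \<psi>) = swap_sum (mix (False, True, True)) (($) \<psi>)"
    unfolding trace_sq_def rho_1_def swap_sum_def sum_product sum.cartesian_product UNIV_Times_UNIV
    by (rule sum.reindex_bij_witness[of _
          "\<lambda>((i, j, k), (i', j', k')). (i, i', (j, k), (j', k'))"
          "\<lambda>(i, i', (j, k), (j', k')). ((i, j, k), (i', j', k'))"])
       (auto simp: mix_def pick_def)
qed

subsection \<open>Averages over product states\<close>

lemma (in pair_sigma_finite)
  fixes f :: "'a \<Rightarrow> complex" and g :: "'b \<Rightarrow> complex"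
  assumes f: "integrable M1 f" and g: "integrable M2 g"
  shows integrable_tensor: "integrable (M1 \<Otimes>\<^sub>M M2) (\<lambda>p. f (fst p) * g (snd p))"
    and integral_tensor:
      "(\<integral>p. f (fst p) * g (snd p) \<partial>(M1 \<Otimes>\<^sub>M M2)) = (\<integral>x. f x \<partial>M1) * (\<integral>y. g y \<partial>M2)"
proof -
  have [measurable]: "f \<in> borel_measurable M1" "g \<in> borel_measurable M2"
    using f g by auto
  show int: "integrable (M1 \<Otimes>\<^sub>M M2) (\<lambda>p. f (fst p) * g (snd p))"
    using f g by (intro Fubini_integrable) (auto simp: norm_mult)
  show "(\<integral>p. f (fst p) * g (snd p) \<partial>(M1 \<Otimes>\<^sub>M M2)) = (\<integral>x. f x \<partial>M1) * (\<integral>y. g y \<partial>M2)"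
    using integral_fst'[OF int] by simp
qed

lemma moment_tensor3:
  "moment J K L M (tensor3 \<psi>1 \<psi>2 \<psi>3) =
     moment (fst J) (fst K) (fst L) (fst M) \<psi>1 *
     (moment (fst (snd J)) (fst (snd K)) (fst (snd L)) (fst (snd M)) \<psi>2 *
      moment (snd (snd J)) (snd (snd K)) (snd (snd L)) (snd (snd M)) \<psi>3)"
  by (simp add: moment_def tensor3_def case_prod_unfold mult_ac)

text \<open>The coefficients do not depend on \<open>\<psi>\<close>, so averaging a purity of
  \<open>U *v \<psi>\<close> reduces to averaging moments.\<close>

lemma swap_sum_matrix_vector:
  fixes U :: "complex^'n^'m"
  shows "swap_sum f (($) (U *v \<psi>)) = (\<Sum>I\<in>UNIV. \<Sum>I'\<in>UNIV. \<Sum>J\<in>UNIV. \<Sum>K\<in>UNIV. \<Sum>L\<in>UNIV. \<Sum>M\<in>UNIV.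
     U $ I $ J * U $ I' $ K * cnj (U $ f I I' $ L) * cnj (U $ f I' I $ M) * moment J K L M \<psi>)"
proof -
  have sum4: "(\<Sum>J\<in>UNIV. a J) * (\<Sum>K\<in>UNIV. b K) * (\<Sum>L\<in>UNIV. c L) * (\<Sum>M\<in>UNIV. d M)
     = (\<Sum>J\<in>UNIV. \<Sum>K\<in>UNIV. \<Sum>L\<in>UNIV. \<Sum>M\<in>UNIV. a J * b K * c L * d M)"
    for a b c d :: "'n \<Rightarrow> complex"
    by (simp only: sum_distrib_left[symmetric] sum_distrib_right[symmetric])
  show ?thesis
    unfolding swap_sum_def matrix_vector_mult_def vec_lambda_beta cnj_sum sum4
    by (intro sum.cong refl) (simp add: moment_def mult_ac)
qed

text \<open>For \<open>w\<close> given by the entries of \<open>U\<close>, \<open>I\<close> and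
  \<open>I'\<close> are row indices, belonging to the unprimed factors, while \<open>J\<close> and
  \<open>K\<close> are column indices, belonging to the primed copy.\<close>

lemma swap_sum_pair_op:
  "swap_sum (pair_op f g) w = (\<Sum>I\<in>UNIV. \<Sum>I'\<in>UNIV. \<Sum>J\<in>UNIV. \<Sum>K\<in>UNIV.
     w (I, J) * w (I', K) * cnj (w (f I I', g J K)) * cnj (w (f I' I, g K J)))"
proof -
  have "swap_sum (pair_op f g) w = (\<Sum>I\<in>UNIV. \<Sum>J\<in>UNIV. \<Sum>I'\<in>UNIV. \<Sum>K\<in>UNIV.
     w (I, J) * w (I', K) * cnj (w (f I I', g J K)) * cnj (w (f I' I, g K J)))"
    by (simp add: swap_sum_def sum.cartesian_product' flip: UNIV_Times_UNIV)
  also have "\<dots> = (\<Sum>I\<in>UNIV. \<Sum>I'\<in>UNIV. \<Sum>J\<in>UNIV. \<Sum>K\<in>UNIV.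
     w (I, J) * w (I', K) * cnj (w (f I I', g J K)) * cnj (w (f I' I, g K J)))"
    by (intro sum.cong refl sum.swap)
  finally show ?thesis .
qed

text \<open>\<open>Z\<close> marks \<open>ab\<close> and \<open>X\<close> marks \<open>x'\<close>,
  so this is the purity bound for the unnormalised state \<open>U\<close> across the cut
  \<open>ab x' | c y'\<close>.\<close>

lemma swap_sum_unitary_ge:
  fixes U :: "complex^('a::finite \<times> 'b::finite \<times> 'c::finite)^('a \<times> 'b \<times> 'c)"
  assumes "unitary_cmat U"
  defines "dm \<equiv> dim_of TYPE('a \<times> 'b \<times> 'c)"
  shows "(real CARD('a \<times> 'b \<times> 'c))\<^sup>2 / min (dm Z * dm X) (dm (neg Z) * dm (neg X))
       \<le> Re (swap_sum (pair_op (mix Z) (mix X)) (\<lambda>p. U $ fst p $ snd p))"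
proof -
  obtain A B where AB: "splitting (mix Z :: 'a \<times> 'b \<times> 'c \<Rightarrow> _) A B" "card A = dm Z" "card B = dm (neg Z)"
    unfolding dm_def using splitting_mix by blast
  obtain C D where CD: "splitting (mix X :: 'a \<times> 'b \<times> 'c \<Rightarrow> _) C D" "card C = dm X" "card D = dm (neg X)"
    unfolding dm_def using splitting_mix by blast
  show ?thesis
    using swap_sum_ge[OF splitting_pair_op[OF AB(1) CD(1)], of "\<lambda>p. U $ fst p $ snd p"]
    unfolding unitary_norm_sum[OF assms(1)] card_cartesian_product AB CD .
qed

section \<open>The bound rewritten as a sum over cuts\<close>

definition moment_denom :: "('a::finite \<times> 'b::finite \<times> 'c::finite) itself \<Rightarrow> nat" where
  "moment_denom _ =
     (CARD('a) * (CARD('a) + 1)) * (CARD('b) * (CARD('b) + 1)) * (CARD('c) * (CARD('c) + 1))"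

lemma sum_Pow_123:
  "(\<Sum>x\<in>Pow {1, 2, 3::nat}. F x) = (\<Sum>X\<in>UNIV. F ((if fst X then {1} else {}) \<union>
      (if fst (snd X) then {2} else {}) \<union> (if snd (snd X) then {3} else {})))"
  by (rule sum.reindex_bij_witness[of _ "\<lambda>X. (if fst X then {1} else {}) \<union>
      (if fst (snd X) then {2} else {}) \<union> (if snd (snd X) then {3} else {})"
      "\<lambda>x. (1 \<in> x, 2 \<in> x, 3 \<in> x)"])
     (auto split: if_splits intro!: arg_cong[where f = F])

text \<open>Each summand is \<open>1 - 1 / m\<close>, and there are eight of them, so the bracket in
  \<open>eps_tilde\<close> collapses to the sum of the \<open>1 / m\<close>. The prefactor is the
  squared dimension over \<open>moment_denom\<close>, which matches the averaged purity
  bound.\<close>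

lemma eps_tilde_eq:
  fixes d :: "nat \<Rightarrow> nat"
  assumes d: "d 1 = CARD('a::finite)" "d 2 = CARD('b::finite)" "d 3 = CARD('c::finite)"
    and pos: "0 < dab" "0 < dc"
  defines "dm \<equiv> dim_of TYPE('a \<times> 'b \<times> 'c)"
  shows "eps_tilde dab dc d = 2 - 2 * ((\<Sum>X\<in>UNIV. (real CARD('a \<times> 'b \<times> 'c))\<^sup>2 /
           min (dab * dm X) (dc * dm (neg X))) / moment_denom TYPE('a \<times> 'b \<times> 'c))"
proof -
  define m where "m X = min (dab * dm X) (dc * dm (neg X))" for X
  \<comment> \<open>Positivity is needed for \<open>(m - 1) / m = 1 - 1 / m\<close>, as division by
    0 yields 0.\<close>
  have m: "m X > 0" for X
    using pos by (simp add: m_def dm_def dim_of_def)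
  define S :: "_ \<Rightarrow> nat set" where "S X = (if fst X then {1} else {}) \<union>
      (if fst (snd X) then {2} else {}) \<union> (if snd (snd X) then {3} else {})" for X :: "bool \<times> bool \<times> bool"
  have "(\<Prod>i\<in>S X. d i) = dm X" "(\<Prod>i\<in>{1,2,3} - S X. d i) = dm (neg X)" for X
    using d by (cases X; auto simp: S_def dm_def dim_of_def neg_def insert_Diff_if)+
  then have "(\<Sum>x\<in>Pow {1,2,3::nat}. (let m = min (dab * (\<Prod>i\<in>x. d i)) (dc * (\<Prod>i\<in>{1,2,3} - x. d i))
                in (real m - 1) / real m)) = (\<Sum>X\<in>UNIV. (real (m X) - 1) / real (m X))"
    unfolding sum_Pow_123 S_def[symmetric] by (simp add: m_def Let_def)
  also have "\<dots> = (\<Sum>X\<in>UNIV. 1 - 1 / real (m X))"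
    using m by (intro sum.cong) (auto simp: diff_divide_distrib)
  also have "\<dots> = 8 - (\<Sum>X\<in>UNIV. 1 / real (m X))"
    by (simp add: sum_subtractf)
  finally have "eps_tilde dab dc d = 2 - 2 * (\<Prod>i\<in>{1,2,3}. real (d i) / (real (d i) + 1)) *
       (\<Sum>X\<in>UNIV. 1 / real (m X))"
    by (simp add: eps_tilde_def)
  also have "(\<Prod>i\<in>{1,2,3}. real (d i) / (real (d i) + 1))
      = (real CARD('a \<times> 'b \<times> 'c))\<^sup>2 / moment_denom TYPE('a \<times> 'b \<times> 'c)"
  proof -
    \<comment> \<open>Each fraction is expanded by its own numerator, which produces the factors
      \<open>n * (n + 1)\<close> of the moments.\<close>
    have "x / (x + 1) * (y / (y + 1) * (z / (z + 1)))
        = (x * (y * z))\<^sup>2 / (x * (x + 1) * (y * (y + 1)) * (z * (z + 1)))"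
      if "x > 0" "y > 0" "z > 0" for x y z :: real
      using that by (simp add: power2_eq_square divide_simps)
    from this[of "real CARD('a)" "real CARD('b)" "real CARD('c)"] show ?thesis
      using d unfolding moment_denom_def of_nat_mult of_nat_add of_nat_1 by simp
  qed
  finally have "eps_tilde dab dc d = 2 - 2 * ((real CARD('a \<times> 'b \<times> 'c))\<^sup>2 *
      (\<Sum>X\<in>UNIV. 1 / real (m X)) / moment_denom TYPE('a \<times> 'b \<times> 'c))"
    by (simp only: times_divide_eq_left times_divide_eq_right mult.assoc)
  then show ?thesis
    unfolding m_def[symmetric] sum_distrib_left times_divide_eq_right mult_1_right .
qed

section \<open>Mean purity of the image of a random product state\<close>

context
  fixes \<mu>1 :: "(complex^'a) measure" and \<mu>2 :: "(complex^'b) measure"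
    and \<mu>3 :: "(complex^'c) measure"
  assumes \<mu>1: "unitarily_invariant_pure_state_measure \<mu>1"
    and \<mu>2: "unitarily_invariant_pure_state_measure \<mu>2"
    and \<mu>3: "unitarily_invariant_pure_state_measure \<mu>3"
begin

interpretation P1: prob_space \<mu>1 using \<mu>1 by (rule prob_space_invariant)
interpretation P2: prob_space \<mu>2 using \<mu>2 by (rule prob_space_invariant)
interpretation P3: prob_space \<mu>3 using \<mu>3 by (rule prob_space_invariant)
interpretation P23: pair_prob_space \<mu>2 \<mu>3 ..
interpretation P: pair_prob_space \<mu>1 "\<mu>2 \<Otimes>\<^sub>M \<mu>3" ..

abbreviation "prod_measure \<equiv> \<mu>1 \<Otimes>\<^sub>M (\<mu>2 \<Otimes>\<^sub>M \<mu>3)"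

abbreviation "prod_state p \<equiv> tensor3 (fst p) (fst (snd p)) (snd (snd p))"

lemma integrable_moment_tensor3:
  "integrable prod_measure (\<lambda>p. moment J K L M (prod_state p))"
  unfolding moment_tensor3
  by (intro P.integrable_tensor P23.integrable_tensor integrable_moment \<mu>1 \<mu>2 \<mu>3)

text \<open>Each factor contributes two indicators, and the product of the three sums has eight
  terms. The triple \<open>X\<close> records for each factor whether \<open>L\<close> takes its
  coordinate from \<open>J\<close> or from \<open>K\<close>; \<open>M\<close> takes the other
  one.\<close>

lemma integral_moment_tensor3:
  "(\<integral>p. moment J K L M (prod_state p) \<partial>prod_measure)
     = (\<Sum>X\<in>UNIV. of_bool (L = mix X J K) * of_bool (M = mix X K J)) / of_nat (moment_denom TYPE('a \<times> 'b \<times> 'c))"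
proof -
  have "(\<integral>p. moment J K L M (prod_state p) \<partial>prod_measure) =
      (\<integral>\<psi>. moment (fst J) (fst K) (fst L) (fst M) \<psi> \<partial>\<mu>1) *
      ((\<integral>\<psi>. moment (fst (snd J)) (fst (snd K)) (fst (snd L)) (fst (snd M)) \<psi> \<partial>\<mu>2) *
       (\<integral>\<psi>. moment (snd (snd J)) (snd (snd K)) (snd (snd L)) (snd (snd M)) \<psi> \<partial>\<mu>3))"
    unfolding moment_tensor3
    by (subst P.integral_tensor)
       (intro P.integrable_tensor P23.integrable_tensor integrable_moment \<mu>1 \<mu>2 \<mu>3
         P23.integral_tensor arg_cong2[of _ _ _ _ "(*)"] refl)+
  also have "\<dots> = (\<Sum>X\<in>UNIV. of_bool (L = mix X J K) * of_bool (M = mix X K J)) / of_nat (moment_denom TYPE('a \<times> 'b \<times> 'c))"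
    unfolding integral_moment[OF \<mu>1] integral_moment[OF \<mu>2] integral_moment[OF \<mu>3]
    by (cases J; cases K; cases L; cases M)
       (simp add: moment_denom_def UNIV_bool mix_def pick_def sum.cartesian_product' of_bool_conj algebra_simps
         flip: UNIV_Times_UNIV)
  finally show ?thesis .
qed

lemma integrable_swap_sum:
  "integrable prod_measure (\<lambda>p. swap_sum f (($) (U *v prod_state p)))"
  unfolding swap_sum_matrix_vector
  by (intro Bochner_Integration.integrable_sum integrable_mult_right integrable_moment_tensor3)

text \<open>The indicators force \<open>L\<close> and \<open>M\<close> to be complementary mixtures
  of \<open>J\<close> and \<open>K\<close>. What remains for each \<open>X\<close> is the purity sum
  of \<open>U\<close> with rows cut by \<open>f\<close> and columns cut by
  \<open>mix X\<close>.\<close>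

lemma integral_swap_sum:
  "(\<integral>p. swap_sum f (($) (U *v prod_state p)) \<partial>prod_measure)
     = (\<Sum>X\<in>UNIV. swap_sum (pair_op f (mix X)) (\<lambda>p. U $ fst p $ snd p)) / of_nat (moment_denom TYPE('a \<times> 'b \<times> 'c))"
proof -
  define u where "u I I' J K L M = U $ I $ J * U $ I' $ K * cnj (U $ f I I' $ L) * cnj (U $ f I' I $ M)"
    for I I' J K L M
  have collapse: "(\<Sum>L\<in>UNIV. \<Sum>M\<in>UNIV. g L M * (\<Sum>X\<in>UNIV. of_bool (L = l X) * of_bool (M = m X)))
      = (\<Sum>X\<in>UNIV. g (l X) (m X))"
    for g :: "'x::finite \<Rightarrow> 'x \<Rightarrow> complex" and l m :: "bool \<times> bool \<times> bool \<Rightarrow> 'x"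
  proof -
    have "(\<Sum>L\<in>UNIV. \<Sum>M\<in>UNIV. g L M * (\<Sum>X\<in>UNIV. of_bool (L = l X) * of_bool (M = m X)))
        = (\<Sum>L\<in>UNIV. \<Sum>X\<in>UNIV. \<Sum>M\<in>UNIV. g L M * (of_bool (L = l X) * of_bool (M = m X)))"
      unfolding sum_distrib_left by (intro sum.cong refl sum.swap)
    also have "\<dots> = (\<Sum>X\<in>UNIV. \<Sum>L\<in>UNIV. \<Sum>M\<in>UNIV. g L M * (of_bool (L = l X) * of_bool (M = m X)))"
      by (rule sum.swap)
    also have "\<dots> = (\<Sum>X\<in>UNIV. g (l X) (m X))"
      by (simp add: of_bool_def if_distrib[of "\<lambda>x. _ * x"] if_distrib[of "\<lambda>x. x * _"] cong: if_cong)
    finally show ?thesis .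
  qed
  have swap: "(\<Sum>I\<in>UNIV. \<Sum>I'\<in>UNIV. \<Sum>J\<in>UNIV. \<Sum>K\<in>UNIV. \<Sum>X\<in>UNIV. h I I' J K X)
    = (\<Sum>X\<in>UNIV. \<Sum>I\<in>UNIV. \<Sum>I'\<in>UNIV. \<Sum>J\<in>UNIV. \<Sum>K\<in>UNIV. h I I' J K X)"
    for h :: "'x::finite \<Rightarrow> 'x \<Rightarrow> 'y::finite \<Rightarrow> 'y \<Rightarrow> bool \<times> bool \<times> bool \<Rightarrow> complex"
    by (simp only: sum.swap[of _ "UNIV :: (bool \<times> bool \<times> bool) set" "UNIV :: 'x set"]
          sum.swap[of _ "UNIV :: (bool \<times> bool \<times> bool) set" "UNIV :: 'y set"])
  have "(\<integral>p. swap_sum f (($) (U *v prod_state p)) \<partial>prod_measure)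
     = (\<Sum>I\<in>UNIV. \<Sum>I'\<in>UNIV. \<Sum>J\<in>UNIV. \<Sum>K\<in>UNIV. \<Sum>L\<in>UNIV. \<Sum>M\<in>UNIV. u I I' J K L M *
          (\<integral>p. moment J K L M (prod_state p) \<partial>prod_measure))"
    unfolding swap_sum_matrix_vector u_def
    by (simp add: Bochner_Integration.integral_sum integrable_moment_tensor3)
  also have "\<dots> = (\<Sum>I\<in>UNIV. \<Sum>I'\<in>UNIV. \<Sum>J\<in>UNIV. \<Sum>K\<in>UNIV. \<Sum>L\<in>UNIV. \<Sum>M\<in>UNIV. u I I' J K L M *
          (\<Sum>X\<in>UNIV. of_bool (L = mix X J K) * of_bool (M = mix X K J))) / of_nat (moment_denom TYPE('a \<times> 'b \<times> 'c))"
    unfolding integral_moment_tensor3 times_divide_eq_right sum_divide_distrib[symmetric] ..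
  also have "\<dots> = (\<Sum>X\<in>UNIV. \<Sum>I\<in>UNIV. \<Sum>I'\<in>UNIV. \<Sum>J\<in>UNIV. \<Sum>K\<in>UNIV.
          u I I' J K (mix X J K) (mix X K J)) / of_nat (moment_denom TYPE('a \<times> 'b \<times> 'c))"
    unfolding collapse swap ..
  finally show ?thesis
    by (simp add: swap_sum_pair_op u_def)
qed

lemma integrable_tangle:
  "integrable prod_measure (\<lambda>p. 2 * (1 - Re (swap_sum f (($) (U *v prod_state p)))))"
  by (intro integrable_mult_right Bochner_Integration.integrable_diff integrable_Re integrable_swap_sum)
     simp

text \<open>The tangle decreases with the purity, so bounding the eight cut purities of
  \<open>U\<close> from below bounds the mean tangle from above.\<close>

lemma integral_tangle_le:
  fixes U :: "complex^('a \<times> 'b \<times> 'c)^('a \<times> 'b \<times> 'c)" and d :: "nat \<Rightarrow> nat"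
  assumes U: "unitary_cmat U"
    and d: "d 1 = CARD('a)" "d 2 = CARD('b)" "d 3 = CARD('c)"
  defines "dm \<equiv> dim_of TYPE('a \<times> 'b \<times> 'c)"
  shows "(\<integral>p. 2 * (1 - Re (swap_sum (mix Z) (($) (U *v prod_state p)))) \<partial>prod_measure)
       \<le> eps_tilde (dm Z) (dm (neg Z)) d"
proof -
  have "(\<integral>p. 2 * (1 - Re (swap_sum (mix Z) (($) (U *v prod_state p)))) \<partial>prod_measure)
     = 2 - 2 * Re (\<integral>p. swap_sum (mix Z) (($) (U *v prod_state p)) \<partial>prod_measure)"
    using integrable_swap_sum[of "mix Z" U] by (simp add: P.prob_space)
  also have "\<dots> = 2 - 2 * ((\<Sum>X\<in>UNIV.
       Re (swap_sum (pair_op (mix Z) (mix X)) (\<lambda>p. U $ fst p $ snd p))) / moment_denom TYPE('a \<times> 'b \<times> 'c))"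
    unfolding integral_swap_sum by (simp only: Re_divide_of_nat Re_sum)
  also have "\<dots> \<le> 2 - 2 * ((\<Sum>X\<in>UNIV. (real CARD('a \<times> 'b \<times> 'c))\<^sup>2 /
           min (dm Z * dm X) (dm (neg Z) * dm (neg X))) / moment_denom TYPE('a \<times> 'b \<times> 'c))"
    unfolding dm_def
    by (intro diff_left_mono mult_left_mono divide_right_mono sum_mono swap_sum_unitary_ge[OF U]) auto
  also have "\<dots> = eps_tilde (dm Z) (dm (neg Z)) d"
    unfolding dm_def by (rule eps_tilde_eq[OF d, symmetric]) (simp_all add: dim_of_def)
  finally show ?thesis .
qed

end

theorem theorem2:
  fixes U :: "complex^('a::finite \<times> 'b::finite \<times> 'c::finite)^('a \<times> 'b \<times> 'c)"
    and \<mu>1 :: "(complex^'a) measure" and \<mu>2 :: "(complex^'b) measure"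
    and \<mu>3 :: "(complex^'c) measure"
  defines "d \<equiv> (\<lambda>i::nat. if i = 1 then CARD('a) else if i = 2 then CARD('b) else CARD('c))"
  assumes "unitary_cmat U"
    and "unitarily_invariant_pure_state_measure \<mu>1"
    and "unitarily_invariant_pure_state_measure \<mu>2"
    and "unitarily_invariant_pure_state_measure \<mu>3"
  shows "avg_prod tau_12_3 U \<mu>1 \<mu>2 \<mu>3 \<le> eps_tilde (d 1 * d 2) (d 3) d
       \<and> avg_prod tau_13_2 U \<mu>1 \<mu>2 \<mu>3 \<le> eps_tilde (d 1 * d 3) (d 2) d
       \<and> avg_prod tau_23_1 U \<mu>1 \<mu>2 \<mu>3 \<le> eps_tilde (d 2 * d 3) (d 1) d
       \<and> avg_prod tau1 U \<mu>1 \<mu>2 \<mu>3 \<le>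
           (eps_tilde (d 1 * d 2) (d 3) d + eps_tilde (d 1 * d 3) (d 2) d
            + eps_tilde (d 2 * d 3) (d 1) d) / 3"
proof -
  note inv = assms(3-5)
  have d: "d 1 = CARD('a)" "d 2 = CARD('b)" "d 3 = CARD('c)"
    by (simp_all add: d_def)
  note le = integral_tangle_le[OF inv assms(2) d]
  have 1: "avg_prod tau_12_3 U \<mu>1 \<mu>2 \<mu>3 \<le> eps_tilde (d 1 * d 2) (d 3) d"
    \<comment> \<open>The triple marks the pair \<open>ab\<close>, so \<open>dm Z\<close> is the
      dimension of the pair and \<open>dm (neg Z)\<close> that of the remaining factor.\<close>
    using le[of "(True, True, False)"]
    by (simp add: avg_prod_def tau_12_3_def trace_sq_rho dim_of_def neg_def d d(1)[unfolded One_nat_def])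
  have 2: "avg_prod tau_13_2 U \<mu>1 \<mu>2 \<mu>3 \<le> eps_tilde (d 1 * d 3) (d 2) d"
    using le[of "(True, False, True)"]
    by (simp add: avg_prod_def tau_13_2_def trace_sq_rho dim_of_def neg_def d d(1)[unfolded One_nat_def])
  have 3: "avg_prod tau_23_1 U \<mu>1 \<mu>2 \<mu>3 \<le> eps_tilde (d 2 * d 3) (d 1) d"
    using le[of "(False, True, True)"]
    by (simp add: avg_prod_def tau_23_1_def trace_sq_rho dim_of_def neg_def d d(1)[unfolded One_nat_def])
  \<comment> \<open>Linearity of the integral, which requires each of the three tangles to be
    integrable.\<close>
  have "avg_prod tau1 U \<mu>1 \<mu>2 \<mu>3 = (avg_prod tau_12_3 U \<mu>1 \<mu>2 \<mu>3
      + avg_prod tau_13_2 U \<mu>1 \<mu>2 \<mu>3 + avg_prod tau_23_1 U \<mu>1 \<mu>2 \<mu>3) / 3"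
    unfolding avg_prod_def tau1_def tau_12_3_def tau_13_2_def tau_23_1_def trace_sq_rho
    by (simp only: integral_divide_zero Bochner_Integration.integral_add
          Bochner_Integration.integrable_add integrable_tangle[OF inv])
  with 1 2 3 show ?thesis by simp
qed

end
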